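(* Let $B$ be a Bol algebra over $\mathbb{K}$, let $V$ be a vector space viewed as a Bol algebra with trivial operations, and let $E_{\widehat{B}}: 0\to V\xrightarrow{i}\widehat{B}\xrightarrow{p}B\to 0$ be an abelian split extension of $B$, with $\sigma:B\to\widehat{B}$ a section of $p$. Define maps $\rho:B\to\mathrm{End}(V)$ and $D,\theta:B\times B\to\mathrm{End}(V)$ by $$\rho(x)(u):=\sigma(x)*_{\widehat{B}}u,\quad D(x_1,x_2)(u):=[\sigma(x_1),\sigma(x_2),u]_{\widehat{B}},\quad \theta(x_1,x_2)(u):=[u,\sigma(x_1),\sigma(x_2)]_{\widehat{B}}$$ for all $x,x_i\in B$ and $u\in V$. Then: (i) $(\rho,D,\theta)$ is a representation of $B$ in $V$; (ii) the representation $(\rho,D,\theta)$ does not depend on the choice of the section $\sigma$; (iii) equivalent abelian split extensions of $B$ (by $V$) give the same representation of $B$.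
   Context: All vector spaces and algebras are finite-dimensional over a field $\mathbb{K}$ of characteristic zero. In $\mathrm{End}(V)$, juxtaposition is composition and $[f,g]=fg-gf$. A Bol algebra is a triple $(B,*,[\,,\,,\,])$ with $B$ a vector space, $*$ a bilinear operation and $[\,,\,,\,]$ a trilinear operation on $B$ such that for all $u,v,w,x,y,z\in B$: (B01) $x*y=-y*x$; (B02) $[x,y,z]=-[y,x,z]$; (B1) $[x,y,z]+[y,z,x]+[z,x,y]=0$; (B2) $[x,y,u*v]=[x,y,u]*v+u*[x,y,v]+[u,v,x*y]-(u*v)*(x*y)$; (B3) $[x,y,[u,v,w]]=[[x,y,u],v,w]+[u,[x,y,v],w]+[u,v,[x,y,w]]$. Homomorphisms are linear maps preserving both operations. A representation of a Bol algebra $B$ in a vector space $V$ is a triple $(\rho,D,\theta)$ with $\rho:B\to\mathrm{End}(V)$ linear and $D,\theta:B\times B\to \mathrm{End}(V)$ bilinear such that for all $x_i,y_i\in B$: (R1) $D(x_1,x_2)+\theta(x_1,x_2)-\theta(x_2,x_1)=0$; (R21) $[D(x_1,x_2),\rho(y_1)]=\rho([x_1,x_2,y_1])-\theta(y_1,x_1*x_2)+\rho(x_1*x_2)\rho(y_1)$; (R22) $\theta(x_1,y_1*y_2)=\rho(y_1)\theta(x_1,y_2)-\rho(y_2)\theta(x_1,y_1)-\big(D(y_1,y_2)-\rho(y_1*y_2)\big)\rho(x_1)$; (R31) $[D(x_1,x_2),D(y_1,y_2)]=D([x_1,x_2,y_1],y_2)+D(y_1,[x_1,x_2,y_2])$;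 (R32) $[D(x_1,x_2),\theta(y_1,y_2)]=\theta([x_1,x_2,y_1],y_2)+\theta(y_1,[x_1,x_2,y_2])$; (R33) $\theta(x_1,[y_1,y_2,y_3])=\theta(y_2,y_3)\theta(x_1,y_1)-\theta(y_1,y_3)\theta(x_1,y_2)+D(y_1,y_2)\theta(x_1,y_3)$. Extensions: let $B$, $V$, $(\widehat{B},*_{\widehat{B}},[\,,\,,\,]_{\widehat{B}})$ be Bol algebras and $i:V\to\widehat{B}$, $p:\widehat{B}\to B$ homomorphisms. $\widehat{B}$ is an extension of $B$ by $V$ if $0\to V\xrightarrow{i}\widehat{B}\xrightarrow{p}B\to0$ is exact. Identifying $V$ with $i(V)$, the extension is abelian if $V$ is an abelian ideal of $\widehat{B}$, i.e. an ideal (any product $*_{\widehat{B}}$ or $[\,,\,,\,]_{\widehat{B}}$ with at least one factor in $V$ lies in $V$) such that $u*_{\widehat{B}}v=0$, $[u,v,\cdot]_{\widehat{B}}=0$, $[u,\cdot,v]_{\widehat{B}}=0$, $[\cdot,u,v]_{\widehat{B}}=0$ for all $u,v\in V$. A section of $p$ is a linear map $\sigma:B\to\widehat{B}$ with $p\circ\sigma=\mathrm{id}_B$, in which case the extension is said to be split. Two extensions $0\to V\xrightarrow{i}\widehat{B}\xrightarrow{p}B\to0$ and $0\to V\xrightarrow{j}\widetilde{B}\xrightarrow{q}B\to0$ are equivalent if there is a Bol algebra homomorphism $\varphi:\widehat{B}\to\widetilde{B}$ with $\varphi\circ i=j$ and $q\circ\varphi=p$. *)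

theory Defs
  imports Complex_Main "HOL-Library.Function_Algebras"
begin

definition fin_dim_space :: "('k::field \<Rightarrow> 'a::ab_group_add \<Rightarrow> 'a) \<Rightarrow> bool" where
  "fin_dim_space s \<longleftrightarrow> (\<exists>Basis. finite_dimensional_vector_space s Basis)"

definition bilinear_map ::
  "('k::field \<Rightarrow> 'a::ab_group_add \<Rightarrow> 'a) \<Rightarrow> ('k \<Rightarrow> 'b::ab_group_add \<Rightarrow> 'b) \<Rightarrow>
   ('k \<Rightarrow> 'c::ab_group_add \<Rightarrow> 'c) \<Rightarrow> ('a \<Rightarrow> 'b \<Rightarrow> 'c) \<Rightarrow> bool" where
  "bilinear_map s1 s2 s3 f \<longleftrightarrow>
     (\<forall>x. Vector_Spaces.linear s2 s3 (\<lambda>y. f x y)) \<and>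
     (\<forall>y. Vector_Spaces.linear s1 s3 (\<lambda>x. f x y))"

definition trilinear_map ::
  "('k::field \<Rightarrow> 'a::ab_group_add \<Rightarrow> 'a) \<Rightarrow> ('k \<Rightarrow> 'b::ab_group_add \<Rightarrow> 'b) \<Rightarrow>
   ('a \<Rightarrow> 'a \<Rightarrow> 'a \<Rightarrow> 'b) \<Rightarrow> bool" where
  "trilinear_map s1 s2 f \<longleftrightarrow>
     (\<forall>y z. Vector_Spaces.linear s1 s2 (\<lambda>x. f x y z)) \<and>
     (\<forall>x z. Vector_Spaces.linear s1 s2 (\<lambda>y. f x y z)) \<and>
     (\<forall>x y. Vector_Spaces.linear s1 s2 (\<lambda>z. f x y z))"

text \<open>
  Endomorphisms are functions \<open>'v \<Rightarrow> 'v\<close>, with the pointwise addition of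
  \<open>Function_Algebras\<close> and the pointwise scalar multiplication below. The product in
  \<open>End(V)\<close> is composition \<open>f \<circ> g\<close>, not the pointwise \<open>f * g\<close>; \<open>\<circ>\<close> binds
  weaker than \<open>+\<close> and \<open>-\<close>, hence the parentheses in the axioms of a representation.
\<close>

definition End :: "('k::field \<Rightarrow> 'v::ab_group_add \<Rightarrow> 'v) \<Rightarrow> ('v \<Rightarrow> 'v) set" where
  "End s = {f. Vector_Spaces.linear s s f}"

definition fun_scale :: "('k \<Rightarrow> 'v \<Rightarrow> 'v) \<Rightarrow> 'k \<Rightarrow> ('v \<Rightarrow> 'v) \<Rightarrow> ('v \<Rightarrow> 'v)" where
  "fun_scale s a f = (\<lambda>v. s a (f v))"

definition commutator :: "('v \<Rightarrow> 'v) \<Rightarrow> ('v \<Rightarrow> 'v) \<Rightarrow> ('v::ab_group_add \<Rightarrow> 'v)" where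
  "commutator f g = (f \<circ> g) - (g \<circ> f)"

text \<open>The additive group of a Bol algebra is that of the type \<open>'a\<close> and is not a record field.\<close>

record ('k, 'a) bol =
  smul :: "'k \<Rightarrow> 'a \<Rightarrow> 'a"
  prd :: "'a \<Rightarrow> 'a \<Rightarrow> 'a"  (infixl "\<star>\<index>" 70)
  brk :: "'a \<Rightarrow> 'a \<Rightarrow> 'a \<Rightarrow> 'a"  ("\<lbrace>_,_,_\<rbrace>\<index>")

locale bol_algebra =
  fixes A :: "('k::field_char_0, 'a::ab_group_add) bol" (structure)
  assumes fin_dim: "fin_dim_space (smul A)"
    and prd_bilinear: "bilinear_map (smul A) (smul A) (smul A) (prd A)"
    and brk_trilinear: "trilinear_map (smul A) (smul A) (brk A)"
    and B01: "x \<star> y = - (y \<star> x)"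
    and B02: "\<lbrace>x, y, z\<rbrace> = - \<lbrace>y, x, z\<rbrace>"
    and B1: "\<lbrace>x, y, z\<rbrace> + \<lbrace>y, z, x\<rbrace> + \<lbrace>z, x, y\<rbrace> = 0"
    and B2: "\<lbrace>x, y, u \<star> v\<rbrace> =
      \<lbrace>x, y, u\<rbrace> \<star> v + u \<star> \<lbrace>x, y, v\<rbrace> + \<lbrace>u, v, x \<star> y\<rbrace> - (u \<star> v) \<star> (x \<star> y)"
    and B3: "\<lbrace>x, y, \<lbrace>u, v, w\<rbrace>\<rbrace> =
      \<lbrace>\<lbrace>x, y, u\<rbrace>, v, w\<rbrace> + \<lbrace>u, \<lbrace>x, y, v\<rbrace>, w\<rbrace> + \<lbrace>u, v, \<lbrace>x, y, w\<rbrace>\<rbrace>"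

definition bol_hom ::
  "('k::field_char_0, 'a::ab_group_add) bol \<Rightarrow> ('k, 'b::ab_group_add) bol \<Rightarrow> ('a \<Rightarrow> 'b) \<Rightarrow> bool"
  where
  "bol_hom A A' f \<longleftrightarrow>
     Vector_Spaces.linear (smul A) (smul A') f \<and>
     (\<forall>x y. f (x \<star>\<^bsub>A\<^esub> y) = f x \<star>\<^bsub>A'\<^esub> f y) \<and>
     (\<forall>x y z. f \<lbrace>x, y, z\<rbrace>\<^bsub>A\<^esub> = \<lbrace>f x, f y, f z\<rbrace>\<^bsub>A'\<^esub>)"

definition trivial_bol :: "('k \<Rightarrow> 'v \<Rightarrow> 'v) \<Rightarrow> ('k, 'v::ab_group_add) bol" where
  "trivial_bol s = \<lparr>smul = s, prd = (\<lambda>_ _. 0), brk = (\<lambda>_ _ _. 0)\<rparr>"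

locale bol_representation =
  bol_algebra B
  for B :: "('k::field_char_0, 'b::ab_group_add) bol" (structure) +
  fixes s :: "'k \<Rightarrow> 'v::ab_group_add \<Rightarrow> 'v"
    and \<rho> :: "'b \<Rightarrow> ('v \<Rightarrow> 'v)"
    and D \<theta> :: "'b \<Rightarrow> 'b \<Rightarrow> ('v \<Rightarrow> 'v)"
  assumes V_fin_dim: "fin_dim_space s"
    and rho_End: "\<rho> x \<in> End s"
    and D_End: "D x y \<in> End s"
    and theta_End: "\<theta> x y \<in> End s"
    and rho_linear: "Vector_Spaces.linear (smul B) (fun_scale s) \<rho>"
    and D_bilinear: "bilinear_map (smul B) (smul B) (fun_scale s) D"
    and theta_bilinear: "bilinear_map (smul B) (smul B) (fun_scale s) \<theta>"
    and R1: "D x1 x2 + \<theta> x1 x2 - \<theta> x2 x1 = 0"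
    and R21: "commutator (D x1 x2) (\<rho> y1) =
      \<rho> \<lbrace>x1, x2, y1\<rbrace> - \<theta> y1 (x1 \<star> x2) + (\<rho> (x1 \<star> x2) \<circ> \<rho> y1)"
    and R22: "\<theta> x1 (y1 \<star> y2) =
      (\<rho> y1 \<circ> \<theta> x1 y2) - (\<rho> y2 \<circ> \<theta> x1 y1) - ((D y1 y2 - \<rho> (y1 \<star> y2)) \<circ> \<rho> x1)"
    and R31: "commutator (D x1 x2) (D y1 y2) =
      D \<lbrace>x1, x2, y1\<rbrace> y2 + D y1 \<lbrace>x1, x2, y2\<rbrace>"
    and R32: "commutator (D x1 x2) (\<theta> y1 y2) =
      \<theta> \<lbrace>x1, x2, y1\<rbrace> y2 + \<theta> y1 \<lbrace>x1, x2, y2\<rbrace>"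
    and R33: "\<theta> x1 \<lbrace>y1, y2, y3\<rbrace> =
      (\<theta> y2 y3 \<circ> \<theta> x1 y1) - (\<theta> y1 y3 \<circ> \<theta> x1 y2) + (D y1 y2 \<circ> \<theta> x1 y3)"

definition bol_ideal :: "('k::field_char_0, 'a::ab_group_add) bol \<Rightarrow> 'a set \<Rightarrow> bool" where
  "bol_ideal A I \<longleftrightarrow>
     module.subspace (smul A) I \<and>
     (\<forall>x y. x \<in> I \<or> y \<in> I \<longrightarrow> x \<star>\<^bsub>A\<^esub> y \<in> I) \<and>
     (\<forall>x y z. x \<in> I \<or> y \<in> I \<or> z \<in> I \<longrightarrow> \<lbrace>x, y, z\<rbrace>\<^bsub>A\<^esub> \<in> I)"

definition abelian_bol_ideal :: "('k::field_char_0, 'a::ab_group_add) bol \<Rightarrow> 'a set \<Rightarrow> bool" where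
  "abelian_bol_ideal A I \<longleftrightarrow>
     bol_ideal A I \<and>
     (\<forall>u\<in>I. \<forall>v\<in>I. u \<star>\<^bsub>A\<^esub> v = 0 \<and>
        (\<forall>x. \<lbrace>u, v, x\<rbrace>\<^bsub>A\<^esub> = 0 \<and> \<lbrace>u, x, v\<rbrace>\<^bsub>A\<^esub> = 0 \<and> \<lbrace>x, u, v\<rbrace>\<^bsub>A\<^esub> = 0))"

definition bol_extension ::
  "('k::field_char_0, 'v::ab_group_add) bol \<Rightarrow> ('k, 'e::ab_group_add) bol \<Rightarrow>
   ('k, 'b::ab_group_add) bol \<Rightarrow> ('v \<Rightarrow> 'e) \<Rightarrow> ('e \<Rightarrow> 'b) \<Rightarrow> bool" where
  "bol_extension V E B i p \<longleftrightarrow>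
     bol_algebra V \<and> bol_algebra E \<and> bol_algebra B \<and>
     bol_hom V E i \<and> bol_hom E B p \<and>
     inj i \<and> range i = {x. p x = 0} \<and> surj p"

definition bol_section ::
  "('k::field_char_0, 'e::ab_group_add) bol \<Rightarrow> ('k, 'b::ab_group_add) bol \<Rightarrow>
   ('e \<Rightarrow> 'b) \<Rightarrow> ('b \<Rightarrow> 'e) \<Rightarrow> bool" where
  "bol_section E B p \<sigma> \<longleftrightarrow> Vector_Spaces.linear (smul B) (smul E) \<sigma> \<and> p \<circ> \<sigma> = id"

definition abelian_split_extension ::
  "('k::field_char_0, 'v::ab_group_add) bol \<Rightarrow> ('k, 'e::ab_group_add) bol \<Rightarrow>
   ('k, 'b::ab_group_add) bol \<Rightarrow> ('v \<Rightarrow> 'e) \<Rightarrow> ('e \<Rightarrow> 'b) \<Rightarrow> bool" where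
  "abelian_split_extension V E B i p \<longleftrightarrow>
     bol_extension V E B i p \<and> abelian_bol_ideal E (range i) \<and> (\<exists>\<sigma>. bol_section E B p \<sigma>)"

definition equivalent_extensions ::
  "('k::field_char_0, 'e::ab_group_add) bol \<Rightarrow> ('v \<Rightarrow> 'e) \<Rightarrow> ('e \<Rightarrow> 'b) \<Rightarrow>
   ('k, 'f::ab_group_add) bol \<Rightarrow> ('v \<Rightarrow> 'f) \<Rightarrow> ('f \<Rightarrow> 'b) \<Rightarrow> bool" where
  "equivalent_extensions E i p F j q \<longleftrightarrow>
     (\<exists>\<phi>. bol_hom E F \<phi> \<and> \<phi> \<circ> i = j \<and> q \<circ> \<phi> = p)"

text \<open>
  With \<open>V\<close> identified with \<open>i(V)\<close>, an element of \<open>i(V)\<close> is read back in \<open>V\<close> by \<open>inv i\<close>;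
  that the products below lie in \<open>i(V)\<close> is lemma \<open>i_induced\<close>.
\<close>

definition induced_rho ::
  "('k, 'e) bol \<Rightarrow> ('v \<Rightarrow> 'e) \<Rightarrow> ('b \<Rightarrow> 'e) \<Rightarrow> 'b \<Rightarrow> ('v \<Rightarrow> 'v)" where
  "induced_rho E i \<sigma> x = (\<lambda>u. inv i (\<sigma> x \<star>\<^bsub>E\<^esub> i u))"

definition induced_D ::
  "('k, 'e) bol \<Rightarrow> ('v \<Rightarrow> 'e) \<Rightarrow> ('b \<Rightarrow> 'e) \<Rightarrow> 'b \<Rightarrow> 'b \<Rightarrow> ('v \<Rightarrow> 'v)" where
  "induced_D E i \<sigma> x1 x2 = (\<lambda>u. inv i \<lbrace>\<sigma> x1, \<sigma> x2, i u\<rbrace>\<^bsub>E\<^esub>)"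

definition induced_theta ::
  "('k, 'e) bol \<Rightarrow> ('v \<Rightarrow> 'e) \<Rightarrow> ('b \<Rightarrow> 'e) \<Rightarrow> 'b \<Rightarrow> 'b \<Rightarrow> ('v \<Rightarrow> 'v)" where
  "induced_theta E i \<sigma> x1 x2 = (\<lambda>u. inv i \<lbrace>i u, \<sigma> x1, \<sigma> x2\<rbrace>\<^bsub>E\<^esub>)"

lemma i_induced:
  assumes "abelian_split_extension V E B i p"
  shows "i (induced_rho E i \<sigma> x u) = \<sigma> x \<star>\<^bsub>E\<^esub> i u"
    and "i (induced_D E i \<sigma> x1 x2 u) = \<lbrace>\<sigma> x1, \<sigma> x2, i u\<rbrace>\<^bsub>E\<^esub>"
    and "i (induced_theta E i \<sigma> x1 x2 u) = \<lbrace>i u, \<sigma> x1, \<sigma> x2\<rbrace>\<^bsub>E\<^esub>"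
  using assms
  by (simp_all add: induced_rho_def induced_D_def induced_theta_def f_inv_into_f
      abelian_split_extension_def abelian_bol_ideal_def bol_ideal_def)

end

theory Submission
  imports Defs
begin

text \<open>
  Since \<open>i(V)\<close> is an abelian ideal, a product with a factor \<open>i u\<close> depends on its other
  factors only modulo \<open>i(V)\<close>, that is, only on their images under \<open>p\<close>. So \<open>\<rho>\<close>, \<open>D\<close>, \<open>\<theta>\<close> may be
  computed with arbitrary lifts in place of \<open>\<sigma> x\<close>. Lifting \<open>x * y\<close> to \<open>\<sigma> x * \<sigma> y\<close> and
  \<open>[x, y, z]\<close> to \<open>[\<sigma> x, \<sigma> y, \<sigma> z]\<close> turns the axioms of a representation into instances of the
  Bol identities of the extension with one argument in \<open>i(V)\<close>; independence of the section and
  invariance under equivalence are immediate.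
\<close>

section \<open>Linear and multilinear maps as rewrite rules\<close>

lemma vector_space_fun_scale:
  assumes "vector_space s"
  shows "vector_space (fun_scale s)"
proof -
  interpret vector_space s by fact
  show ?thesis
    by unfold_locales (auto simp: fun_scale_def fun_eq_iff algebra_simps)
qed

lemma linearD:
  assumes "Vector_Spaces.linear s1 s2 f"
  shows "f (x + y) = f x + f y" "f (x - y) = f x - f y" "f (- x) = - f x" "f 0 = 0"
    "f (s1 c x) = s2 c (f x)"
proof -
  interpret Vector_Spaces.linear s1 s2 f by fact
  show "f (x + y) = f x + f y" "f (x - y) = f x - f y" "f (- x) = - f x" "f 0 = 0"
    "f (s1 c x) = s2 c (f x)"
    by (simp_all add: add diff neg scale)
qed

context bol_algebra
begin

lemma vector_space_smul: "vector_space (smul A)"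
  using fin_dim by (auto simp: fin_dim_space_def finite_dimensional_vector_space_def)

lemma linear_prd:
  "Vector_Spaces.linear (smul A) (smul A) (\<lambda>x. x \<star> y)"
  "Vector_Spaces.linear (smul A) (smul A) (\<lambda>y. x \<star> y)"
  using prd_bilinear by (auto simp: bilinear_map_def)

lemma linear_brk:
  "Vector_Spaces.linear (smul A) (smul A) (\<lambda>x. \<lbrace>x, y, z\<rbrace>)"
  "Vector_Spaces.linear (smul A) (smul A) (\<lambda>y. \<lbrace>x, y, z\<rbrace>)"
  "Vector_Spaces.linear (smul A) (smul A) (\<lambda>z. \<lbrace>x, y, z\<rbrace>)"
  using brk_trilinear by (auto simp: trilinear_map_def)

lemmas prd_linear_simps = linear_prd[THEN linearD(1)] linear_prd[THEN linearD(2)]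
  linear_prd[THEN linearD(3)] linear_prd[THEN linearD(5)]

lemmas brk_linear_simps = linear_brk[THEN linearD(1)] linear_brk[THEN linearD(2)]
  linear_brk[THEN linearD(3)] linear_brk[THEN linearD(5)]

end

section \<open>A split extension with a chosen section\<close>

locale split_extension =
  fixes B :: "('k::field_char_0, 'b::ab_group_add) bol"
    and s :: "'k \<Rightarrow> 'v::ab_group_add \<Rightarrow> 'v"
    and E :: "('k, 'e::ab_group_add) bol"
    and i :: "'v \<Rightarrow> 'e" and p :: "'e \<Rightarrow> 'b" and \<sigma> :: "'b \<Rightarrow> 'e"
  assumes ext: "abelian_split_extension (trivial_bol s) E B i p"
    and sec: "bol_section E B p \<sigma>"
begin

abbreviation "\<rho> \<equiv> induced_rho E i \<sigma>"
abbreviation "D \<equiv> induced_D E i \<sigma>"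
abbreviation "\<theta> \<equiv> induced_theta E i \<sigma>"

sublocale E: bol_algebra E
  using ext by (simp add: abelian_split_extension_def bol_extension_def)

sublocale B: bol_algebra B
  using ext by (simp add: abelian_split_extension_def bol_extension_def)

lemma fin_dim_s: "fin_dim_space s"
  using ext
  by (auto simp: abelian_split_extension_def bol_extension_def trivial_bol_def
      dest: bol_algebra.fin_dim)

lemma vector_space_s: "vector_space s"
  using fin_dim_s by (auto simp: fin_dim_space_def finite_dimensional_vector_space_def)

lemma linear_i: "Vector_Spaces.linear s (smul E) i"
  using ext
  by (simp add: abelian_split_extension_def bol_extension_def bol_hom_def trivial_bol_def)

lemma linear_sigma: "Vector_Spaces.linear (smul B) (smul E) \<sigma>"
  using sec by (simp add: bol_section_def)

lemma p_hom: "bol_hom E B p"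
  using ext by (simp add: abelian_split_extension_def bol_extension_def)

lemma p_prd: "p (x \<star>\<^bsub>E\<^esub> y) = p x \<star>\<^bsub>B\<^esub> p y"
  and p_brk: "p \<lbrace>x, y, z\<rbrace>\<^bsub>E\<^esub> = \<lbrace>p x, p y, p z\<rbrace>\<^bsub>B\<^esub>"
  using p_hom by (simp_all add: bol_hom_def)

lemma p_sigma: "p (\<sigma> x) = x"
  using sec by (simp add: bol_section_def fun_eq_iff)

lemma i_eq_iff: "i u = i v \<longleftrightarrow> u = v"
  using ext by (auto simp: abelian_split_extension_def bol_extension_def dest: injD)

lemmas i_simps = linearD[OF linear_i]
lemmas sigma_simps = linearD[OF linear_sigma]

section \<open>Products with \<open>i u\<close> modulo \<open>i(V)\<close>\<close>

lemma diff_in_range: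
  assumes "p a = p b"
  shows "a - b \<in> range i"
proof -
  have "Vector_Spaces.linear (smul E) (smul B) p"
    using p_hom by (simp add: bol_hom_def)
  then have "p (a - b) = 0"
    using assms by (simp add: linearD(2))
  then show ?thesis
    using ext by (simp add: abelian_split_extension_def bol_extension_def)
qed

text \<open>These are the positions that matter below: \<open>i u\<close> stands last in the
  products giving \<open>\<rho>\<close> and \<open>D\<close> and first in the one giving
  \<open>\<theta>\<close>, while \<open>v\<close>, a difference of two lifts, fills a slot of a
  lifted argument.\<close>

lemma range_i_abelian:
  assumes "v \<in> range i"
  shows "v \<star>\<^bsub>E\<^esub> i u = 0" "\<lbrace>v, x, i u\<rbrace>\<^bsub>E\<^esub> = 0" "\<lbrace>x, v, i u\<rbrace>\<^bsub>E\<^esub> = 0"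
    "\<lbrace>i u, v, x\<rbrace>\<^bsub>E\<^esub> = 0" "\<lbrace>i u, x, v\<rbrace>\<^bsub>E\<^esub> = 0"
  using ext assms by (auto simp: abelian_split_extension_def abelian_bol_ideal_def)

lemma i_rho_lift:
  assumes "p a = x"
  shows "i (\<rho> x u) = a \<star>\<^bsub>E\<^esub> i u"
proof -
  have "\<sigma> x - a \<in> range i"
    by (rule diff_in_range) (simp add: p_sigma assms)
  from range_i_abelian(1)[OF this, of u] show ?thesis
    by (simp add: i_induced[OF ext] E.prd_linear_simps)
qed

lemma i_D_lift:
  assumes "p a = x" "p b = y"
  shows "i (D x y u) = \<lbrace>a, b, i u\<rbrace>\<^bsub>E\<^esub>"
proof -
  have a: "\<sigma> x - a \<in> range i" and b: "\<sigma> y - b \<in> range i"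
    by (auto intro!: diff_in_range simp: p_sigma assms)
  \<comment> \<open>The two lifts are exchanged one at a time, so each step uses linearity in a
    single slot and one vanishing bracket.\<close>
  have "\<lbrace>\<sigma> x, \<sigma> y, i u\<rbrace>\<^bsub>E\<^esub> = \<lbrace>a, \<sigma> y, i u\<rbrace>\<^bsub>E\<^esub>"
    using range_i_abelian(2)[OF a, of "\<sigma> y" u] by (simp add: E.brk_linear_simps)
  also have "\<dots> = \<lbrace>a, b, i u\<rbrace>\<^bsub>E\<^esub>"
    using range_i_abelian(3)[OF b, of a u] by (simp add: E.brk_linear_simps)
  finally show ?thesis
    by (simp add: i_induced[OF ext])
qed

lemma i_theta_lift:
  assumes "p a = x" "p b = y"
  shows "i (\<theta> x y u) = \<lbrace>i u, a, b\<rbrace>\<^bsub>E\<^esub>"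
proof -
  have a: "\<sigma> x - a \<in> range i" and b: "\<sigma> y - b \<in> range i"
    by (auto intro!: diff_in_range simp: p_sigma assms)
  have "\<lbrace>i u, \<sigma> x, \<sigma> y\<rbrace>\<^bsub>E\<^esub> = \<lbrace>i u, a, \<sigma> y\<rbrace>\<^bsub>E\<^esub>"
    using range_i_abelian(4)[OF a, of u "\<sigma> y"] by (simp add: E.brk_linear_simps)
  also have "\<dots> = \<lbrace>i u, a, b\<rbrace>\<^bsub>E\<^esub>"
    using range_i_abelian(5)[OF b, of u a] by (simp add: E.brk_linear_simps)
  finally show ?thesis
    by (simp add: i_induced[OF ext])
qed

text \<open>A section need not preserve products, but next to an element of \<open>i(V)\<close> it
  may be treated as if it did. Read from left to right, the rules remove the operations of
  \<open>B\<close>. The second rule is the first at \<open>\<rho> z u\<close>, restated for the form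
  that \<open>i (\<rho> z u)\<close> takes once it is unfolded; it serves the composites
  \<open>\<rho> (x * y) \<circ> \<rho> z\<close>.\<close>

lemma sigma_prd_lift:
  "\<sigma> (x \<star>\<^bsub>B\<^esub> y) \<star>\<^bsub>E\<^esub> i u = (\<sigma> x \<star>\<^bsub>E\<^esub> \<sigma> y) \<star>\<^bsub>E\<^esub> i u"
  "\<sigma> (x \<star>\<^bsub>B\<^esub> y) \<star>\<^bsub>E\<^esub> (\<sigma> z \<star>\<^bsub>E\<^esub> i u) = (\<sigma> x \<star>\<^bsub>E\<^esub> \<sigma> y) \<star>\<^bsub>E\<^esub> (\<sigma> z \<star>\<^bsub>E\<^esub> i u)"
  "\<lbrace>i u, \<sigma> z, \<sigma> (x \<star>\<^bsub>B\<^esub> y)\<rbrace>\<^bsub>E\<^esub> = \<lbrace>i u, \<sigma> z, \<sigma> x \<star>\<^bsub>E\<^esub> \<sigma> y\<rbrace>\<^bsub>E\<^esub>"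
  using i_rho_lift[of "\<sigma> x \<star>\<^bsub>E\<^esub> \<sigma> y"]
    i_rho_lift[of "\<sigma> x \<star>\<^bsub>E\<^esub> \<sigma> y" "x \<star>\<^bsub>B\<^esub> y" "\<rho> z u"]
    i_theta_lift[of "\<sigma> z" z "\<sigma> x \<star>\<^bsub>E\<^esub> \<sigma> y"]
  by (simp_all add: p_prd p_sigma i_induced[OF ext])

lemma sigma_brk_lift:
  "\<sigma> \<lbrace>x, y, z\<rbrace>\<^bsub>B\<^esub> \<star>\<^bsub>E\<^esub> i u = \<lbrace>\<sigma> x, \<sigma> y, \<sigma> z\<rbrace>\<^bsub>E\<^esub> \<star>\<^bsub>E\<^esub> i u"
  "\<lbrace>\<sigma> \<lbrace>x, y, z\<rbrace>\<^bsub>B\<^esub>, \<sigma> w, i u\<rbrace>\<^bsub>E\<^esub> = \<lbrace>\<lbrace>\<sigma> x, \<sigma> y, \<sigma> z\<rbrace>\<^bsub>E\<^esub>, \<sigma> w, i u\<rbrace>\<^bsub>E\<^esub>"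
  "\<lbrace>\<sigma> w, \<sigma> \<lbrace>x, y, z\<rbrace>\<^bsub>B\<^esub>, i u\<rbrace>\<^bsub>E\<^esub> = \<lbrace>\<sigma> w, \<lbrace>\<sigma> x, \<sigma> y, \<sigma> z\<rbrace>\<^bsub>E\<^esub>, i u\<rbrace>\<^bsub>E\<^esub>"
  "\<lbrace>i u, \<sigma> \<lbrace>x, y, z\<rbrace>\<^bsub>B\<^esub>, \<sigma> w\<rbrace>\<^bsub>E\<^esub> = \<lbrace>i u, \<lbrace>\<sigma> x, \<sigma> y, \<sigma> z\<rbrace>\<^bsub>E\<^esub>, \<sigma> w\<rbrace>\<^bsub>E\<^esub>"
  "\<lbrace>i u, \<sigma> w, \<sigma> \<lbrace>x, y, z\<rbrace>\<^bsub>B\<^esub>\<rbrace>\<^bsub>E\<^esub> = \<lbrace>i u, \<sigma> w, \<lbrace>\<sigma> x, \<sigma> y, \<sigma> z\<rbrace>\<^bsub>E\<^esub>\<rbrace>\<^bsub>E\<^esub>"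
  using i_rho_lift[of "\<lbrace>\<sigma> x, \<sigma> y, \<sigma> z\<rbrace>\<^bsub>E\<^esub>"] i_D_lift[of "\<lbrace>\<sigma> x, \<sigma> y, \<sigma> z\<rbrace>\<^bsub>E\<^esub>" _ "\<sigma> w" w]
    i_D_lift[of "\<sigma> w" w "\<lbrace>\<sigma> x, \<sigma> y, \<sigma> z\<rbrace>\<^bsub>E\<^esub>"] i_theta_lift[of "\<lbrace>\<sigma> x, \<sigma> y, \<sigma> z\<rbrace>\<^bsub>E\<^esub>" _ "\<sigma> w" w]
    i_theta_lift[of "\<sigma> w" w "\<lbrace>\<sigma> x, \<sigma> y, \<sigma> z\<rbrace>\<^bsub>E\<^esub>"]
  by (simp_all add: p_brk p_sigma i_induced[OF ext])

section \<open>The axioms of a representation\<close>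

lemmas pull_back = i_eq_iff[symmetric] i_simps i_induced[OF ext] sigma_simps
  E.prd_linear_simps E.brk_linear_simps

lemma representation: "bol_representation B s \<rho> D \<theta>"
proof (intro bol_representation.intro bol_representation_axioms.intro)
  note vs = vector_space_s vector_space_fun_scale[OF vector_space_s] B.vector_space_smul
  show "bol_algebra B" by (rule B.bol_algebra_axioms)
  show "fin_dim_space s" by (rule fin_dim_s)
  show "\<rho> x \<in> End s" "D x y \<in> End s" "\<theta> x y \<in> End s" for x y
    \<comment> \<open>By injectivity of \<open>i\<close>, \<open>pull_back\<close> moves an equation
      in \<open>V\<close> to \<open>E\<close>, where multilinearity of the operations and linearity
      of \<open>\<sigma>\<close> settle it. The reversed \<open>i_eq_iff\<close> does not loop,
      since it leads from equations of type \<open>'v\<close> to equations of type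
      \<open>'e\<close>.\<close>
    by (simp_all add: End_def Vector_Spaces.linear_iff vs pull_back)
  show "Vector_Spaces.linear (smul B) (fun_scale s) \<rho>"
    by (simp add: Vector_Spaces.linear_iff vs fun_eq_iff fun_scale_def pull_back)
  show "bilinear_map (smul B) (smul B) (fun_scale s) D"
    "bilinear_map (smul B) (smul B) (fun_scale s) \<theta>"
    by (simp_all add: bilinear_map_def Vector_Spaces.linear_iff vs fun_eq_iff fun_scale_def
        pull_back)
  \<comment> \<open>In place of linearity of \<open>\<sigma>\<close>, the axioms need the lifting
    rules for products and brackets of \<open>B\<close>.\<close>
  note to_E = commutator_def i_eq_iff[symmetric] i_simps i_induced[OF ext]
    sigma_prd_lift sigma_brk_lift E.prd_linear_simps E.brk_linear_simps
  fix x1 x2 y1 y2 y3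
  \<comment> \<open>B1 gives three terms; B02 turns the middle one, with \<open>i u\<close> in the
    second slot, into \<open>- \<theta> x2 x1\<close>.\<close>
  show "D x1 x2 + \<theta> x1 x2 - \<theta> x2 x1 = 0" (is "?l = ?r")
  proof
    show "?l u = ?r u" for u
      using E.B1[of "\<sigma> x1" "\<sigma> x2" "i u"] E.B02[of "\<sigma> x2" "i u" "\<sigma> x1"]
      by (simp add: to_E algebra_simps)
  qed
  \<comment> \<open>B2 with \<open>i u\<close> as the second factor of the inner product. B02
    produces the sign of the \<open>\<theta>\<close> term, and B01 makes the last product a
    composite of two values of \<open>\<rho>\<close>.\<close>
  show "commutator (D x1 x2) (\<rho> y1) =
      \<rho> \<lbrace>x1, x2, y1\<rbrace>\<^bsub>B\<^esub> - \<theta> y1 (x1 \<star>\<^bsub>B\<^esub> x2) + (\<rho> (x1 \<star>\<^bsub>B\<^esub> x2) \<circ> \<rho> y1)" (is "?l = ?r")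
  proof
    show "?l u = ?r u" for u
      using E.B2[of "\<sigma> x1" "\<sigma> x2" "\<sigma> y1" "i u"] E.B02[of "\<sigma> y1" "i u"]
        E.B01[of "\<sigma> y1 \<star>\<^bsub>E\<^esub> i u" "\<sigma> x1 \<star>\<^bsub>E\<^esub> \<sigma> x2"]
      by (simp add: to_E algebra_simps)
  qed
  \<comment> \<open>B2 again, now with \<open>i u\<close> as the first entry of the outer bracket.
    Both uses of B01 move the element of \<open>i(V)\<close> to the right, where
    \<open>\<rho>\<close> expects it.\<close>
  show "\<theta> x1 (y1 \<star>\<^bsub>B\<^esub> y2) =
      (\<rho> y1 \<circ> \<theta> x1 y2) - (\<rho> y2 \<circ> \<theta> x1 y1) - ((D y1 y2 - \<rho> (y1 \<star>\<^bsub>B\<^esub> y2)) \<circ> \<rho> x1)"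
    (is "?l = ?r")
  proof
    show "?l u = ?r u" for u
      using E.B2[of "i u" "\<sigma> x1" "\<sigma> y1" "\<sigma> y2"] E.B01[of "\<lbrace>i u, \<sigma> x1, \<sigma> y1\<rbrace>\<^bsub>E\<^esub>" "\<sigma> y2"]
        E.B01[of "i u" "\<sigma> x1"]
      by (simp add: to_E algebra_simps)
  qed
  \<comment> \<open>R31, R32 and R33 are B3 with \<open>i u\<close> in the last slot, the first
    inner slot and the first outer slot respectively. Only R33 needs B02 as well, to bring
    \<open>\<theta> x1 y2\<close> into the first slot of the middle bracket.\<close>
  show "commutator (D x1 x2) (D y1 y2) =
      D \<lbrace>x1, x2, y1\<rbrace>\<^bsub>B\<^esub> y2 + D y1 \<lbrace>x1, x2, y2\<rbrace>\<^bsub>B\<^esub>" (is "?l = ?r")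
  proof
    show "?l u = ?r u" for u
      by (simp add: to_E E.B3[of "\<sigma> x1" "\<sigma> x2" "\<sigma> y1" "\<sigma> y2" "i u"])
  qed
  show "commutator (D x1 x2) (\<theta> y1 y2) =
      \<theta> \<lbrace>x1, x2, y1\<rbrace>\<^bsub>B\<^esub> y2 + \<theta> y1 \<lbrace>x1, x2, y2\<rbrace>\<^bsub>B\<^esub>" (is "?l = ?r")
  proof
    show "?l u = ?r u" for u
      by (simp add: to_E E.B3[of "\<sigma> x1" "\<sigma> x2" "i u" "\<sigma> y1" "\<sigma> y2"])
  qed
  show "\<theta> x1 \<lbrace>y1, y2, y3\<rbrace>\<^bsub>B\<^esub> =
      (\<theta> y2 y3 \<circ> \<theta> x1 y1) - (\<theta> y1 y3 \<circ> \<theta> x1 y2) + (D y1 y2 \<circ> \<theta> x1 y3)" (is "?l = ?r")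
  proof
    show "?l u = ?r u" for u
      by (simp add: to_E E.B3[of "i u" "\<sigma> x1" "\<sigma> y1" "\<sigma> y2" "\<sigma> y3"]
          E.B02[of "\<sigma> y1" "\<lbrace>i u, \<sigma> x1, \<sigma> y2\<rbrace>\<^bsub>E\<^esub>"])
  qed
qed

end

section \<open>Equivalent extensions and change of section\<close>

lemma equivalent_extensions_induced:
  assumes "abelian_split_extension (trivial_bol s) E B i p" "bol_section E B p \<sigma>"
    and "abelian_split_extension (trivial_bol s) F B j q" "bol_section F B q \<tau>"
    and "equivalent_extensions E i p F j q"
  shows "induced_rho F j \<tau> = induced_rho E i \<sigma> \<and>
    induced_D F j \<tau> = induced_D E i \<sigma> \<and>
    induced_theta F j \<tau> = induced_theta E i \<sigma>"
proof -
  interpret E: split_extension B s E i p \<sigma>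
    using assms by unfold_locales
  interpret F: split_extension B s F j q \<tau>
    using assms by unfold_locales
  obtain \<phi> where hom: "bol_hom E F \<phi>" and j: "\<And>u. \<phi> (i u) = j u" and q: "\<And>e. q (\<phi> e) = p e"
    using assms(5) by (auto simp: equivalent_extensions_def fun_eq_iff)
  have phi_prd: "\<phi> (x \<star>\<^bsub>E\<^esub> y) = \<phi> x \<star>\<^bsub>F\<^esub> \<phi> y"
    and phi_brk: "\<phi> \<lbrace>x, y, z\<rbrace>\<^bsub>E\<^esub> = \<lbrace>\<phi> x, \<phi> y, \<phi> z\<rbrace>\<^bsub>F\<^esub>" for x y z
    using hom by (simp_all add: bol_hom_def)
  \<comment> \<open>Thus \<open>\<phi> (\<sigma> x)\<close> is a lift of \<open>x\<close> to
    \<open>F\<close>, and the maps induced by \<open>\<tau>\<close> can be computed with it. Since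
    also \<open>j u = \<phi> (i u)\<close>, the resulting products in \<open>F\<close> are the
    images under \<open>\<phi>\<close> of those in \<open>E\<close>.\<close>
  have lift: "q (\<phi> (\<sigma> x)) = x" for x
    by (simp add: q E.p_sigma)
  have "j (F.\<rho> x u) = j (E.\<rho> x u)" for x u
    \<comment> \<open>The rule is instantiated so that only the right-hand side becomes a value of
      \<open>\<phi>\<close>; the left-hand side keeps the form that \<open>F.i_rho_lift\<close>
      rewrites.\<close>
    unfolding j[of "E.\<rho> x u", symmetric] F.i_rho_lift[OF lift]
    by (simp add: i_induced[OF assms(1)] phi_prd j)
  moreover have "j (F.D x y u) = j (E.D x y u)" for x y u
    unfolding j[of "E.D x y u", symmetric] F.i_D_lift[OF lift lift]
    by (simp add: i_induced[OF assms(1)] phi_brk j)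
  moreover have "j (F.\<theta> x y u) = j (E.\<theta> x y u)" for x y u
    unfolding j[of "E.\<theta> x y u", symmetric] F.i_theta_lift[OF lift lift]
    by (simp add: i_induced[OF assms(1)] phi_brk j)
  ultimately show ?thesis
    by (simp add: fun_eq_iff F.i_eq_iff)
qed

lemma equivalent_extensions_refl:
  assumes "bol_algebra E"
  shows "equivalent_extensions E i p E i p"
proof -
  have "bol_hom E E id"
    using bol_algebra.vector_space_smul[OF assms]
    by (simp add: bol_hom_def Vector_Spaces.linear_iff)
  then show ?thesis
    by (auto simp: equivalent_extensions_def)
qed

theorem proposition4p3:
  fixes B :: "('k::field_char_0, 'b::ab_group_add) bol"
    and s :: "'k \<Rightarrow> 'v::ab_group_add \<Rightarrow> 'v"
    and E :: "('k, 'e::ab_group_add) bol"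
    and i :: "'v \<Rightarrow> 'e" and p :: "'e \<Rightarrow> 'b" and \<sigma> :: "'b \<Rightarrow> 'e"
  assumes "bol_algebra B"
    and "fin_dim_space s"
    and "abelian_split_extension (trivial_bol s) E B i p"
    and "bol_section E B p \<sigma>"
  shows "bol_representation B s (induced_rho E i \<sigma>) (induced_D E i \<sigma>) (induced_theta E i \<sigma>)
    \<and> (\<forall>\<sigma>'. bol_section E B p \<sigma>' \<longrightarrow>
          induced_rho E i \<sigma>' = induced_rho E i \<sigma> \<and>
          induced_D E i \<sigma>' = induced_D E i \<sigma> \<and>
          induced_theta E i \<sigma>' = induced_theta E i \<sigma>)
    \<and> (\<forall>(F :: ('k, 'f::ab_group_add) bol) j q \<tau>.
          abelian_split_extension (trivial_bol s) F B j q \<longrightarrow>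
          bol_section F B q \<tau> \<longrightarrow>
          equivalent_extensions E i p F j q \<longrightarrow>
          induced_rho F j \<tau> = induced_rho E i \<sigma> \<and>
          induced_D F j \<tau> = induced_D E i \<sigma> \<and>
          induced_theta F j \<tau> = induced_theta E i \<sigma>)"
proof (intro conjI allI impI)
  interpret split_extension B s E i p \<sigma>
    using assms by unfold_locales
  show "bol_representation B s (induced_rho E i \<sigma>) (induced_D E i \<sigma>) (induced_theta E i \<sigma>)"
    by (rule representation)
  fix \<sigma>'
  assume "bol_section E B p \<sigma>'"
  \<comment> \<open>Independence of the section is the case where the extension is compared with
    itself through the identity, with \<open>\<sigma>'\<close> as the section on the other
    side.\<close>
  note equivalent_extensions_induced[OF ext sec ext this
      equivalent_extensions_refl[OF E.bol_algebra_axioms]]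
  then show "induced_rho E i \<sigma>' = induced_rho E i \<sigma>" "induced_D E i \<sigma>' = induced_D E i \<sigma>"
    "induced_theta E i \<sigma>' = induced_theta E i \<sigma>"
    by blast+
qed (use equivalent_extensions_induced[OF assms(3,4)] in blast)+

end
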